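(* Let $f\in\{g\in\mathcal{C}^1[-1,1]: g'\in\mathcal{BV}[-1,1]\}$ and let $(N_n)_{n\in\mathbb{N}}$ be a sequence of natural numbers with $$\lim_{n\to\infty}\frac{n^4}{N_n}=0.$$ Then the least squares approximations converge pointwise: $LS_n^{N_n}[f](x)\to f(x)$ as $n\to\infty$ for each $x\in[-1,1]$.
   Context: $\mathcal{BV}[-1,1]$ is the set of real functions on $[-1,1]$ of finite total variation. For $N\ge n$, let $x_\mu=-1+2\mu/N$, $\mu=0,\dots,N$, and let $\mathcal{P}_n$ be the space of real polynomials of degree at most $n$. The (unweighted) least squares operator $LS_n^N:\mathcal{C}[-1,1]\to\mathcal{P}_n$ assigns to $f$ the unique polynomial $LS_n^N[f]\in\mathcal{P}_n$ with $$\sum_{\mu=0}^N\left(LS_n^N[f](x_\mu)-f(x_\mu)\right)^2=\min_{p\in\mathcal{P}_n}\sum_{\mu=0}^N\left(p(x_\mu)-f(x_\mu)\right)^2.$$ Under the hypothesis on $(N_n)$, $N_n\ge n$ for all sufficiently large $n$, so $LS_n^{N_n}[f]$ is defined for those $n$. *)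

theory Defs
  imports "HOL-Analysis.Analysis" "HOL-Computational_Algebra.Polynomial"
begin

definition partitions :: "real \<Rightarrow> real \<Rightarrow> (nat \<times> (nat \<Rightarrow> real)) set" where
  "partitions a b =
     {(m, t). t 0 = a \<and> t m = b \<and> (\<forall>i<m. t i < t (Suc i))}"

definition total_variation :: "real \<Rightarrow> real \<Rightarrow> (real \<Rightarrow> real) \<Rightarrow> ennreal" where
  "total_variation a b g =
     (SUP (m, t) \<in> partitions a b. ennreal (\<Sum>i<m. \<bar>g (t (Suc i)) - g (t i)\<bar>))"

(* A function on [a,b] is represented by a total function; only its values on [a,b] matter. *)
definition BV :: "real \<Rightarrow> real \<Rightarrow> (real \<Rightarrow> real) set" where
  "BV a b = {g. total_variation a b g < \<infinity>}"

definition node :: "nat \<Rightarrow> nat \<Rightarrow> real" where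
  "node N \<mu> = -1 + 2 * real \<mu> / real N"

definition sq_error :: "nat \<Rightarrow> (real \<Rightarrow> real) \<Rightarrow> real poly \<Rightarrow> real" where
  "sq_error N f p = (\<Sum>\<mu>\<le>N. (poly p (node N \<mu>) - f (node N \<mu>))\<^sup>2)"

(* The minimizer is unique exactly when n \<le> N; for n > N the value is unspecified. *)
definition LS :: "nat \<Rightarrow> nat \<Rightarrow> (real \<Rightarrow> real) \<Rightarrow> real poly" where
  "LS N n f = (THE p. is_arg_min (sq_error N f) (\<lambda>q. degree q \<le> n) p)"

end

theory Submission
  imports Defs
begin

text \<open>
  Since \<open>LS\<close> is a projection onto the polynomials of degree at most \<open>n\<close>, a polynomial of
  fixed degree may be subtracted from \<open>f\<close> without changing the error.  Approximating \<open>f'\<close>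
  uniformly by a polynomial and integrating leaves a remainder \<open>u\<close> with Lipschitz constant
  \<open>\<epsilon>\<close> as small as desired (\<open>C1_poly_plus_small_lipschitz\<close>).  It therefore suffices to show
  that the error \<open>e = u - LS u\<close> of an \<open>\<epsilon>\<close>-Lipschitz function is at most a constant times
  \<open>\<epsilon>\<close>, uniformly on \<open>[-1,1]\<close>, as soon as \<open>N\<close> is at least a constant times \<open>n\<^sup>2\<close>
  (\<open>uniform_projection_error\<close>).  Two facts are combined.

  The first is that \<open>e\<close> is of size \<open>\<epsilon>/n\<close> in discrete root mean square
  (\<open>projection_error_bound\<close>).  The polynomials orthogonal for the counting measure on the
  nodes, the Gram or discrete Chebyshev polynomials, are eigenvectors of a second order
  difference operator of Sturm-Liouville type, with eigenvalues \<open>k * (k + 1)\<close>, in the same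
  way as Legendre polynomials are for their differential operator.  The quadratic form of that
  operator is a weighted sum of squared differences between neighbouring nodes, which is at
  most \<open>4 * \<epsilon>\<^sup>2 * N\<close> on \<open>u\<close>, and the part of \<open>u\<close> beyond degree \<open>n\<close> only feels eigenvalues
  from \<open>(n + 1) * (n + 2)\<close> on.

  The second is Markov's inequality for polynomials (\<open>markov\<close>): if \<open>\<bar>e\<bar>\<close> attained a maximum
  \<open>M\<close> much larger than \<open>\<epsilon>\<close>, the polynomial part of \<open>e\<close> would have slope of order at most
  \<open>n\<^sup>2 * M\<close>, so \<open>\<bar>e\<bar>\<close> would stay above \<open>M/2\<close> on an interval of length about \<open>1/n\<^sup>2\<close>.  For \<open>N\<close>
  large compared with \<open>n\<^sup>2\<close> a proportion of about \<open>1/n\<^sup>2\<close> of the nodes lies in that interval, so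
  the root mean square would be of order at least \<open>M/n\<close>, contradicting the bound \<open>\<epsilon>/n\<close>.
\<close>

section \<open>Markov's inequality\<close>

text \<open>
  A polynomial with as many roots left of \<open>b\<close> as its degree allows is a constant multiple of
  \<open>\<Prod>z. X - z\<close>; the constant is positive if the value at \<open>b\<close> is, and then all factors are
  positive and increasing at \<open>b\<close>.
\<close>

lemma pderiv_nonneg_right_of_roots:
  fixes p :: "real poly"
  assumes "finite Z" "degree p \<le> card Z" "\<And>z. z \<in> Z \<Longrightarrow> poly p z = 0 \<and> z < b" "poly p b > 0"
  shows "poly (pderiv p) b \<ge> 0"
  using assms
proof (induction "card Z" arbitrary: p Z)
  case 0
  then obtain c where "p = [:c:]" by (metis degree_eq_zeroE le_zero_eq)
  then show ?case by (simp add: pderiv_pCons)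
next
  case (Suc n)
  then obtain z where z: "z \<in> Z" by fastforce
  then obtain r where r: "p = [:-z, 1:] * r"
    using Suc.prems(3) by (meson dvdE poly_eq_0_iff_dvd)
  have zb: "z < b" using Suc.prems(3) z by blast
  have rb: "poly r b > 0"
  proof -
    have "poly p b = (b - z) * poly r b" by (simp add: r algebra_simps)
    then show ?thesis using Suc.prems(4) zb by (simp add: zero_less_mult_iff)
  qed
  have "r \<noteq> 0" using rb by auto
  then have "degree p = Suc (degree r)" by (simp add: r degree_mult_eq del: mult_pCons_left)
  moreover have card: "card (Z - {z}) = n" using Suc.hyps(2) Suc.prems(1) z by simp
  ultimately have deg: "degree r \<le> card (Z - {z})" using Suc.prems(2) Suc.hyps(2) by simp
  have roots: "poly r y = 0 \<and> y < b" if "y \<in> Z - {z}" for y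
    using Suc.prems(3)[of y] that by (auto simp: r)
  have "poly (pderiv r) b \<ge> 0"
    using Suc.hyps(1)[OF card[symmetric] _ deg roots rb] Suc.prems(1) by blast
  moreover have "poly (pderiv p) b = (b - z) * poly (pderiv r) b + poly r b"
    unfolding r pderiv_mult by (simp add: pderiv_pCons algebra_simps)
  ultimately show ?case using rb zb by simp
qed

fun chebyshev_T :: "nat \<Rightarrow> real poly" where
  "chebyshev_T 0 = 1"
| "chebyshev_T (Suc 0) = [:0, 1:]"
| "chebyshev_T (Suc (Suc n)) = smult 2 ([:0, 1:] * chebyshev_T (Suc n)) - chebyshev_T n"

lemma degree_chebyshev_T: "degree (chebyshev_T n) \<le> n"
proof (induction n rule: chebyshev_T.induct)
  case (3 n)
  have "degree ([:0, 1:] * chebyshev_T (Suc n)) \<le> Suc (Suc n)"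
    using degree_mult_le[of "[:0,1::real:]" "chebyshev_T (Suc n)"] 3(1) by (simp del: mult_pCons_left)
  then show ?case
    using 3 by (auto intro!: degree_diff_le order.trans[OF degree_smult_le] simp del: mult_pCons_left)
qed auto

lemma poly_chebyshev_T_cos: "poly (chebyshev_T n) (cos t) = cos (real n * t)"
proof (induction n rule: chebyshev_T.induct)
  case (3 n)
  have "cos (real (Suc (Suc n)) * t) + cos (real n * t) = 2 * cos t * cos (real (Suc n) * t)"
    using cos_add[of "real (Suc n) * t" t] cos_diff[of "real (Suc n) * t" t]
    by (simp add: algebra_simps)
  then show ?case using 3 by (simp add: algebra_simps)
qed auto

lemma pderiv_chebyshev_T_at_1: "poly (pderiv (chebyshev_T n)) 1 = (real n)\<^sup>2"
proof (induction n rule: chebyshev_T.induct)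
  case (3 n)
  have "poly (chebyshev_T (Suc n)) 1 = 1" using poly_chebyshev_T_cos[of "Suc n" 0] by simp
  then show ?case
    using 3 by (simp add: pderiv_diff pderiv_smult pderiv_mult pderiv_pCons power2_eq_square algebra_simps)
qed (auto simp: pderiv_pCons)

text \<open>
  The Chebyshev polynomial \<open>B * T\<^sub>n\<close> is extremal.  It takes the values \<open>\<plusminus>B\<close> alternately at the
  \<open>n + 1\<close> points \<open>cos (k * pi / n)\<close>, so \<open>B * T\<^sub>n - q\<close> changes sign between any two neighbours and
  has \<open>n\<close> roots left of \<open>1\<close>.  Being positive at \<open>1\<close>, it has a nonnegative derivative there.
\<close>

lemma markov_at_1_upper:
  fixes q :: "real poly"
  assumes deg: "degree q \<le> n" and bound: "\<And>x. x \<in> {-1..1} \<Longrightarrow> \<bar>poly q x\<bar> < B"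
  shows "poly (pderiv q) 1 \<le> (real n)\<^sup>2 * B"
proof -
  define p where "p = smult B (chebyshev_T n) - q"
  define c where "c k = cos (real k * pi / real n)" for k
  have p_c: "(-1) ^ k * poly p (c k) > 0" if "0 < n" for k
  proof -
    have "poly (chebyshev_T n) (c k) = (-1) ^ k"
      unfolding c_def poly_chebyshev_T_cos using that by (simp add: mult.commute)
    then have "(-1) ^ k * poly p (c k) = B - (-1) ^ k * poly q (c k)"
      by (simp add: p_def algebra_simps flip: power_mult_distrib)
    moreover have "\<bar>(-1) ^ k * poly q (c k)\<bar> < B"
      using bound[of "c k"] by (simp add: c_def abs_mult)
    ultimately show ?thesis by linarith
  qed
  have c_mono: "c k < c j" if "j < k" "k \<le> n" for j k
    unfolding c_def using that
    by (intro cos_monotone_0_pi) (auto simp: field_simps)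
  have "\<exists>z. c (Suc k) < z \<and> z < c k \<and> poly p z = 0" if "k < n" for k
  proof (rule poly_IVT)
    show "c (Suc k) < c k" using c_mono that by simp
    have "0 < ((-1) ^ k * poly p (c k)) * ((-1) ^ Suc k * poly p (c (Suc k)))"
      using p_c that by (intro mult_pos_pos[OF p_c p_c]) auto
    also have "\<dots> = - (poly p (c (Suc k)) * poly p (c k))"
      by (simp add: algebra_simps flip: power_mult_distrib)
    finally show "poly p (c (Suc k)) * poly p (c k) < 0" by simp
  qed
  then obtain z where z: "\<And>k. k < n \<Longrightarrow> c (Suc k) < z k \<and> z k < c k \<and> poly p (z k) = 0"
    by metis
  have z_mono: "z k < z j" if "j < k" "k < n" for j k
  proof -
    have "c k \<le> c (Suc j)" using c_mono[of "Suc j" k] that by (cases "Suc j = k") auto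
    then show ?thesis using z[of k] z[of j] that by linarith
  qed
  have inj: "inj_on z {..<n}"
    by (rule inj_onI) (metis lessThan_iff linorder_neqE_nat order_less_irrefl z_mono)
  have "poly (pderiv p) 1 \<ge> 0"
  proof (rule pderiv_nonneg_right_of_roots)
    show "finite (z ` {..<n})" by simp
    have "degree p \<le> n"
      unfolding p_def using deg degree_chebyshev_T[of n]
      by (intro degree_diff_le order.trans[OF degree_smult_le])
    then show "degree p \<le> card (z ` {..<n})" by (simp add: card_image inj)
    show "poly p y = 0 \<and> y < 1" if y: "y \<in> z ` {..<n}" for y
    proof -
      obtain k where k: "k < n" "y = z k" using y by auto
      have "c k \<le> 1" by (simp add: c_def)
      then show ?thesis using k z[of k] by auto
    qed
    have "poly (chebyshev_T n) 1 = 1" using poly_chebyshev_T_cos[of n 0] by simp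
    then show "poly p 1 > 0" using bound[of 1] by (simp add: p_def)
  qed
  then show ?thesis by (simp add: p_def pderiv_diff pderiv_smult pderiv_chebyshev_T_at_1 mult.commute)
qed

text \<open>
  The endpoint estimate is applied to the larger of the two intervals into which \<open>x\<close> splits
  \<open>[-1,1]\<close>.  That interval has length at least \<open>1\<close>, half that of \<open>[-1,1]\<close>; hence the factor \<open>2\<close>,
  which is not optimal.
\<close>

lemma markov:
  fixes q :: "real poly"
  assumes deg: "degree q \<le> n" and bound: "\<And>x. x \<in> {-1..1} \<Longrightarrow> \<bar>poly q x\<bar> < B"
    and x: "x \<in> {-1..1}"
  shows "\<bar>poly (pderiv q) x\<bar> \<le> 2 * (real n)\<^sup>2 * B"
proof -
  define y :: real where "y = (if x \<ge> 0 then -1 else 1)"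
  define d where "d = (x - y) / 2"
  have d: "\<bar>d\<bar> \<ge> 1/2" "y \<in> {-1..1}" using x by (auto simp: d_def y_def)
  have "B > 0" using bound[of 0] by simp
  define r where "r = q \<circ>\<^sub>p [:(x + y) / 2, d:]"
  have r_bound: "\<bar>poly r t\<bar> < B" if "t \<in> {-1..1}" for t
  proof -
    have "(x + y) / 2 + t * d = (1 + t) / 2 * x + (1 - t) / 2 * y"
      by (simp add: d_def field_simps)
    moreover have "(1 + t) / 2 * x + (1 - t) / 2 * y \<in> {-1..1}"
      using convexD[OF convex_real_interval(5)[of "-1::real" 1] x d(2), of "(1 + t) / 2" "(1 - t) / 2"]
        that by (auto simp: field_simps)
    ultimately show ?thesis using bound by (simp add: r_def poly_pcompose)
  qed
  have "degree r \<le> n"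
    using degree_pcompose_le[of q "[:(x + y) / 2, d:]"] deg
    by (auto simp: r_def split: if_splits)
  then have "\<bar>poly (pderiv r) 1\<bar> \<le> (real n)\<^sup>2 * B"
    using markov_at_1_upper[of r n B] markov_at_1_upper[of "- r" n B] r_bound
    by (simp add: pderiv_minus abs_le_iff)
  moreover have "poly (pderiv r) 1 = d * poly (pderiv q) x"
    by (simp add: r_def pderiv_pcompose poly_pcompose pderiv_pCons d_def field_simps)
  moreover have "1/2 * \<bar>poly (pderiv q) x\<bar> \<le> \<bar>d\<bar> * \<bar>poly (pderiv q) x\<bar>"
    using d(1) by (intro mult_right_mono) auto
  ultimately show ?thesis by (simp add: abs_mult)
qed

section \<open>The discrete inner product and its Sturm-Liouville operator\<close>

definition node_inner :: "nat \<Rightarrow> (real \<Rightarrow> real) \<Rightarrow> (real \<Rightarrow> real) \<Rightarrow> real" where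
  "node_inner N u v = (\<Sum>j\<le>N. u (node N j) * v (node N j))"

definition orth_poly_upto :: "nat \<Rightarrow> nat \<Rightarrow> (real \<Rightarrow> real) \<Rightarrow> bool" where
  "orth_poly_upto N n u \<longleftrightarrow> (\<forall>p. degree p \<le> n \<longrightarrow> node_inner N u (poly p) = 0)"

text \<open>
  The Dirichlet form whose weight \<open>(j + 1) * (N - j)\<close> is the discrete counterpart of the Legendre
  weight \<open>1 - x\<^sup>2\<close> (up to the factor \<open>N\<^sup>2 / 4\<close>).
\<close>

definition dirichlet :: "nat \<Rightarrow> (real \<Rightarrow> real) \<Rightarrow> (real \<Rightarrow> real) \<Rightarrow> real" where
  "dirichlet N u v = (\<Sum>j<N. real (Suc j) * real (N - j) *
     (u (node N (Suc j)) - u (node N j)) * (v (node N (Suc j)) - v (node N j)))"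

definition shift_diff :: "real \<Rightarrow> real poly \<Rightarrow> real poly" where
  "shift_diff h p = p \<circ>\<^sub>p [:h, 1:] - p"

text \<open>
  At \<open>node N j\<close> this polynomial has the value \<open>j * (N + 1 - j)\<close>: the weight of the Dirichlet form
  on the pair of nodes \<open>j - 1\<close>, \<open>j\<close>, vanishing at both ends \<open>j = 0\<close> and \<open>j = N + 1\<close>.
\<close>

definition sturm_weight :: "nat \<Rightarrow> real poly" where
  "sturm_weight N = [:real N / 2, real N / 2:] * [:real N / 2 + 1, - real N / 2:]"

text \<open>
  With the steps \<open>-2/N\<close> and \<open>2/N\<close>, the inner difference is the negative of the backward difference
  and the outer one is a forward difference, so this is the operator \<open>p \<mapsto> - \<Delta> (w * \<nabla> p)\<close>, the
  positive semidefinite operator that represents the Dirichlet form.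
\<close>

definition sturm_op :: "nat \<Rightarrow> real poly \<Rightarrow> real poly" where
  "sturm_op N p = shift_diff (2 / real N) (sturm_weight N * shift_diff (- 2 / real N) p)"

lemma node_Suc: "node N (Suc j) = node N j + 2 / real N"
  by (simp add: node_def add_divide_distrib)

lemma inj_node: "N > 0 \<Longrightarrow> inj (node N)"
  by (auto simp: inj_def node_def)

lemma node_in: "j \<le> N \<Longrightarrow> node N j \<in> {-1..1}"
  by (cases "N = 0") (auto simp: node_def field_simps)

lemma node_inner_commute: "node_inner N u v = node_inner N v u"
  by (simp add: node_inner_def mult.commute)

lemma node_inner_add: "node_inner N (\<lambda>x. u x + v x) w = node_inner N u w + node_inner N v w"
  by (simp add: node_inner_def sum.distrib algebra_simps)

lemma node_inner_diff: "node_inner N (\<lambda>x. u x - v x) w = node_inner N u w - node_inner N v w"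
  by (simp add: node_inner_def sum_subtractf algebra_simps)

lemma node_inner_scale: "node_inner N (\<lambda>x. a * u x) w = a * node_inner N u w"
  by (simp add: node_inner_def sum_distrib_left algebra_simps)

lemma node_inner_self_nonneg: "node_inner N u u \<ge> 0"
  by (simp add: node_inner_def sum_nonneg)

lemma node_inner_self_eq_0: "node_inner N u u = 0 \<longleftrightarrow> (\<forall>j\<le>N. u (node N j) = 0)"
  by (auto simp: node_inner_def sum_nonneg_eq_0_iff)

lemma orth_poly_upto_diff: "orth_poly_upto N n u \<Longrightarrow> orth_poly_upto N n v \<Longrightarrow> orth_poly_upto N n (\<lambda>x. u x - v x)"
  by (simp add: orth_poly_upto_def node_inner_diff)

lemma orth_poly_upto_scale: "orth_poly_upto N n u \<Longrightarrow> orth_poly_upto N n (\<lambda>x. a * u x)"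
  by (simp add: orth_poly_upto_def node_inner_scale)

lemma node_inner_poly_smult_add:
  "node_inner N u (poly (smult a p + r)) = a * node_inner N u (poly p) + node_inner N u (poly r)"
proof -
  have "poly (smult a p + r) = (\<lambda>x. a * poly p x + poly r x)" by auto
  then show ?thesis by (simp add: node_inner_commute[of N u] node_inner_add node_inner_scale)
qed

lemma poly_zero_of_nodes:
  assumes "N > 0" "degree p \<le> N" "\<And>j. j \<le> N \<Longrightarrow> poly p (node N j) = 0"
  shows "p = 0"
proof (rule poly_eqI_degree)
  have "card (node N ` {..N}) = Suc N"
    using inj_on_subset[OF inj_node[OF assms(1)] subset_UNIV] by (simp add: card_image)
  then show "card (node N ` {..N}) > degree p" "card (node N ` {..N}) > degree (0 :: real poly)"
    using assms(2) by auto
qed (use assms(3) in auto)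

lemma orth_poly_upto_Suc:
  assumes orth: "orth_poly_upto N n u" and ortho: "node_inner N u (poly p) = 0"
    and p: "degree p = Suc n" "lead_coeff p = 1"
  shows "orth_poly_upto N (Suc n) u"
  unfolding orth_poly_upto_def
proof (intro allI impI)
  fix r :: "real poly" assume r: "degree r \<le> Suc n"
  define s where "s = r - smult (coeff r (Suc n)) p"
  have "degree s \<le> n"
  proof (rule degree_le, intro allI impI)
    fix i assume "n < i"
    then consider "i = Suc n" | "i > Suc n" by linarith
    then show "coeff s i = 0"
      using r p by cases (auto simp: s_def coeff_eq_0)
  qed
  then have "node_inner N u (poly s) = 0" using orth by (simp add: orth_poly_upto_def)
  moreover have "r = smult (coeff r (Suc n)) p + s" by (simp add: s_def)
  ultimately show "node_inner N u (poly r) = 0"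
    using ortho node_inner_poly_smult_add by (metis add.right_neutral mult_zero_right)
qed

text \<open>
  One Gram-Schmidt step: the monomial minus its projection.  The norm is nonzero because a nonzero
  polynomial of degree at most \<open>N\<close> cannot vanish at all \<open>N + 1\<close> nodes.
\<close>

lemma monic_orth_of_projection:
  assumes N: "N > 0" "Suc n \<le> N" and m: "degree m \<le> n"
    and orth: "orth_poly_upto N n (\<lambda>x. poly (monom 1 (Suc n)) x - poly m x)"
  obtains p where "degree p = Suc n" "lead_coeff p = 1" "orth_poly_upto N n (poly p)"
    "node_inner N (poly p) (poly p) \<noteq> 0"
proof
  define p where "p = monom 1 (Suc n) - m"
  have lc: "coeff p (Suc n) = 1" using m by (simp add: p_def coeff_eq_0)
  have "degree p \<le> Suc n" using m by (auto simp: p_def intro!: degree_diff_le degree_monom_le)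
  then show deg: "degree p = Suc n" using lc le_degree[of p "Suc n"] by simp
  then show "lead_coeff p = 1" using lc by simp
  have "poly p = (\<lambda>x. poly (monom 1 (Suc n)) x - poly m x)" by (auto simp: p_def)
  then show "orth_poly_upto N n (poly p)" using orth by simp
  show "node_inner N (poly p) (poly p) \<noteq> 0"
  proof
    assume "node_inner N (poly p) (poly p) = 0"
    then have "p = 0"
      using N deg by (intro poly_zero_of_nodes[of N]) (auto simp: node_inner_self_eq_0)
    then show False using deg by simp
  qed
qed

lemma orth_remove_component:
  assumes u: "orth_poly_upto N n u"
    and p: "degree p = Suc n" "lead_coeff p = 1" "orth_poly_upto N n (poly p)"
      "node_inner N (poly p) (poly p) \<noteq> 0"
    and a: "a = node_inner N u (poly p) / node_inner N (poly p) (poly p)"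
  shows "orth_poly_upto N (Suc n) (\<lambda>x. u x - a * poly p x)"
proof (rule orth_poly_upto_Suc[OF _ _ p(1,2)])
  show "orth_poly_upto N n (\<lambda>x. u x - a * poly p x)"
    by (intro orth_poly_upto_diff orth_poly_upto_scale u p(3))
  show "node_inner N (\<lambda>x. u x - a * poly p x) (poly p) = 0"
    using p(4) by (simp only: node_inner_diff[of N _ "\<lambda>x. a * poly p x"] node_inner_scale) (simp add: a)
qed

lemma ex_projection:
  assumes "N > 0" "n \<le> N"
  shows "\<exists>q. degree q \<le> n \<and> orth_poly_upto N n (\<lambda>x. u x - poly q x)"
  using assms(2)
proof (induction n arbitrary: u)
  case 0
  define a where "a = node_inner N u (\<lambda>_. 1) / real (Suc N)"
  have "node_inner N (\<lambda>x. u x - poly [:a:] x) (poly p) = 0" if p: "degree p = 0" for p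
  proof -
    obtain c where "p = [:c:]" using p by (rule degree_eq_zeroE)
    moreover have "node_inner N (\<lambda>x. u x - a) (\<lambda>_. 1) = 0"
      by (simp add: node_inner_def a_def sum_subtractf del: of_nat_Suc)
    moreover have "node_inner N w (\<lambda>_. c) = c * node_inner N w (\<lambda>_. 1)" for w
      by (simp add: node_inner_def sum_distrib_left mult.commute)
    moreover have "poly [:c:] = (\<lambda>_. c)" "poly [:a:] = (\<lambda>_. a)" by auto
    ultimately show ?thesis by simp
  qed
  then show ?case by (intro exI[of _ "[:a:]"]) (simp add: orth_poly_upto_def)
next
  case (Suc n)
  obtain m where m: "degree m \<le> n" "orth_poly_upto N n (\<lambda>x. poly (monom 1 (Suc n)) x - poly m x)"
    using Suc.IH Suc.prems by (meson Suc_leD)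
  obtain q where q: "degree q \<le> n" "orth_poly_upto N n (\<lambda>x. u x - poly q x)"
    using Suc.IH Suc.prems by (meson Suc_leD)
  obtain p where p: "degree p = Suc n" "lead_coeff p = 1" "orth_poly_upto N n (poly p)"
      "node_inner N (poly p) (poly p) \<noteq> 0"
    using monic_orth_of_projection[OF assms(1) Suc.prems m] by blast
  define a where "a = node_inner N (\<lambda>x. u x - poly q x) (poly p) / node_inner N (poly p) (poly p)"
  define w where "w x = (u x - poly q x) - a * poly p x" for x
  have "orth_poly_upto N (Suc n) w"
    unfolding w_def by (rule orth_remove_component[OF q(2) p a_def])
  moreover have "w = (\<lambda>x. u x - poly (q + smult a p) x)" by (auto simp: w_def)
  moreover have "degree (q + smult a p) \<le> Suc n"
    using q(1) p(1) by (intro degree_add_le order.trans[OF degree_smult_le]) auto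
  ultimately show ?case by metis
qed

lemma shift_diff_coeff:
  assumes "degree p \<le> Suc k"
  shows "degree (shift_diff h p) \<le> k" "coeff (shift_diff h p) k = real (Suc k) * h * coeff p (Suc k)"
proof -
  have *: "coeff (p \<circ>\<^sub>p [:h, 1:]) i = coeff p i + real (Suc i) * h * coeff p (Suc i)"
    if "degree p \<le> Suc i" for p :: "real poly" and i
    using that
  proof (induction p arbitrary: i)
    case (pCons a p)
    have deg: "degree p \<le> i" using pCons.prems pCons.hyps by (auto split: if_splits)
    show ?case
    proof (cases i)
      case 0
      then show ?thesis
        using pCons.IH[of 0] deg by (simp add: pcompose_pCons coeff_eq_0 algebra_simps)
    next
      case (Suc l)
      have "coeff (p \<circ>\<^sub>p [:h, 1:]) i = coeff p i"
        using pCons.IH[of i] deg by (simp add: coeff_eq_0)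
      moreover have "coeff (p \<circ>\<^sub>p [:h, 1:]) l = coeff p l + real (Suc l) * h * coeff p (Suc l)"
        using pCons.IH[of l] deg Suc by simp
      ultimately show ?thesis
        using Suc by (simp add: pcompose_pCons algebra_simps)
    qed
  qed simp
  show "coeff (shift_diff h p) k = real (Suc k) * h * coeff p (Suc k)"
    using *[OF assms] by (simp add: shift_diff_def)
  show "degree (shift_diff h p) \<le> k"
  proof (rule degree_le, intro allI impI)
    fix i assume "k < i"
    then show "coeff (shift_diff h p) i = 0"
      using *[of p i] assms by (simp add: shift_diff_def coeff_eq_0)
  qed
qed

text \<open>
  A backward difference lowers the degree, the quadratic weight raises it by two and a forward
  difference lowers it again.  So the operator acts on polynomials of degree at most \<open>k\<close>, and modulo
  lower degree it multiplies by \<open>k * (k + 1)\<close>; these numbers become its eigenvalues.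
\<close>

lemma sturm_op_coeff:
  assumes "N > 0" "degree p \<le> k"
  shows "degree (sturm_op N p) \<le> k" "coeff (sturm_op N p) k = real k * real (Suc k) * coeff p k"
proof -
  have "degree (sturm_op N p) \<le> k \<and> coeff (sturm_op N p) k = real k * real (Suc k) * coeff p k"
  proof (cases k)
    case 0
    then obtain c where "p = [:c:]" using assms by (metis degree_eq_zeroE le_zero_eq)
    then show ?thesis using 0 by (simp add: sturm_op_def shift_diff_def)
  next
    case (Suc l)
    define g where "g = shift_diff (- 2 / real N) p"
    have g: "degree g \<le> l" "coeff g l = real (Suc l) * (- 2 / real N) * coeff p (Suc l)"
      using shift_diff_coeff[of p l] assms(2) Suc by (auto simp: g_def)
    have W: "sturm_weight N = [:real N / 2 * (real N / 2 + 1), real N / 2, - (real N / 2)\<^sup>2:]"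
      by (simp add: sturm_weight_def power2_eq_square algebra_simps)
    have deg: "degree (sturm_weight N * g) \<le> Suc (Suc l)"
    proof -
      have "degree (sturm_weight N) \<le> 2" by (simp add: W)
      then show ?thesis using degree_mult_le[of "sturm_weight N" g] g(1) by linarith
    qed
    have "coeff (sturm_weight N * g) (Suc (Suc l)) = - (real N / 2)\<^sup>2 * coeff g l"
      using g(1) by (simp add: W coeff_eq_0)
    then have "coeff (sturm_op N p) (Suc l) = real (Suc (Suc l)) * (2 / real N) * (- (real N / 2)\<^sup>2 * coeff g l)"
      using shift_diff_coeff(2)[OF deg] by (simp add: sturm_op_def g_def)
    also have "\<dots> = real (Suc l) * real (Suc (Suc l)) * coeff p (Suc l)"
      using assms(1) by (simp add: g(2) power2_eq_square field_simps del: of_nat_Suc)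
    finally show ?thesis using shift_diff_coeff(1)[OF deg] Suc by (simp add: sturm_op_def g_def)
  qed
  then show "degree (sturm_op N p) \<le> k" "coeff (sturm_op N p) k = real k * real (Suc k) * coeff p k" by auto
qed

lemma summation_by_parts:
  fixes a v :: "nat \<Rightarrow> real"
  shows "(\<Sum>j<N. a (Suc j) * (v (Suc j) - v j))
    = (\<Sum>j\<le>N. (a j - a (Suc j)) * v j) - a 0 * v 0 + a (Suc N) * v N"
  by (induction N) (auto simp: algebra_simps)

text \<open>
  Summation by parts; the boundary terms drop out because the weight vanishes at \<open>j = 0\<close> and
  \<open>j = N + 1\<close>.
\<close>

lemma dirichlet_eq_node_inner:
  assumes "N > 0"
  shows "dirichlet N (poly p) v = node_inner N (poly (sturm_op N p)) v"
proof -
  define h where "h = 2 / real N"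
  define a where "a j = poly (sturm_weight N) (node N j) * (poly p (node N j) - poly p (node N j - h))" for j
  have W: "poly (sturm_weight N) (node N j) = real j * (real N + 1 - real j)" for j
    using assms by (simp add: sturm_weight_def node_def field_simps)
  have node: "node N (Suc j) = node N j + h" for j by (simp add: node_Suc h_def)
  have "dirichlet N (poly p) v = (\<Sum>j<N. a (Suc j) * (v (node N (Suc j)) - v (node N j)))"
    unfolding dirichlet_def a_def W by (intro sum.cong) (auto simp: node of_nat_diff)
  also have "\<dots> = (\<Sum>j\<le>N. (a j - a (Suc j)) * v (node N j))"
    by (subst summation_by_parts) (simp add: a_def W)
  also have "\<dots> = node_inner N (poly (sturm_op N p)) v"
    unfolding node_inner_def
  proof (intro sum.cong refl)
    fix j
    have "poly (sturm_op N p) (node N j) = a j - a (Suc j)"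
      by (simp add: sturm_op_def shift_diff_def poly_pcompose a_def node flip: h_def)
        (simp add: h_def algebra_simps)
    then show "(a j - a (Suc j)) * v (node N j) = poly (sturm_op N p) (node N j) * v (node N j)" by simp
  qed
  finally show ?thesis .
qed

lemma dirichlet_commute: "dirichlet N u v = dirichlet N v u"
  by (simp add: dirichlet_def mult.assoc mult.commute mult.left_commute)

lemma dirichlet_nonneg: "dirichlet N u u \<ge> 0"
  unfolding dirichlet_def by (intro sum_nonneg) (simp add: mult.assoc)

lemma dirichlet_expand:
  "dirichlet N (\<lambda>x. a * u x + v x) (\<lambda>x. a * u x + v x)
    = a\<^sup>2 * dirichlet N u u + 2 * a * dirichlet N u v + dirichlet N v v"
  unfolding dirichlet_def sum_distrib_left sum.distrib[symmetric]
  by (intro sum.cong) (auto simp: power2_eq_square algebra_simps)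

lemma node_inner_expand:
  "node_inner N (\<lambda>x. a * u x + v x) (\<lambda>x. a * u x + v x)
    = a\<^sup>2 * node_inner N u u + 2 * a * node_inner N u v + node_inner N v v"
  unfolding node_inner_def sum_distrib_left sum.distrib[symmetric]
  by (intro sum.cong) (auto simp: power2_eq_square algebra_simps)

text \<open>
  The polynomial vanishing at every node except the \<open>k\<close>-th has degree \<open>N\<close> and singles out \<open>u (node N k)\<close>.
\<close>

lemma orth_all_nodes_zero:
  assumes "N > 0" "orth_poly_upto N N u" "k \<le> N"
  shows "u (node N k) = 0"
proof -
  define p where "p = (\<Prod>j\<in>{..N} - {k}. [:- node N j, 1:])"
  have "degree p \<le> card ({..N} - {k})"
    unfolding p_def by (rule order.trans[OF degree_prod_sum_le]) auto
  then have "node_inner N u (poly p) = 0"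
    using assms by (simp add: orth_poly_upto_def)
  moreover have "node_inner N u (poly p) = (\<Sum>j\<in>{k}. u (node N j) * poly p (node N j))"
    unfolding node_inner_def using assms(3)
    by (intro sum.mono_neutral_right) (auto simp: p_def poly_prod)
  moreover have "poly p (node N k) \<noteq> 0"
    using injD[OF inj_node[OF assms(1)]] by (auto simp: p_def poly_prod)
  ultimately show ?thesis by simp
qed

text \<open>
  Downward induction on \<open>n\<close> avoids writing down the complete eigenbasis.  The orthogonal polynomial
  \<open>p\<close> of degree \<open>n + 1\<close> is an eigenvector: by self-adjointness its image is again orthogonal to all
  lower degrees, hence a multiple of \<open>p\<close>.  Splitting off the \<open>p\<close>-component of \<open>e\<close> therefore
  decouples both quadratic forms, and the rest is orthogonal to one more degree.
\<close>

lemma spectral_gap: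
  assumes "N > 0" "n \<le> N" "orth_poly_upto N n e"
  shows "real (Suc n) * real (Suc (Suc n)) * node_inner N e e \<le> dirichlet N e e"
  using assms(2,3)
proof (induction n arbitrary: e rule: inc_induct)
  case base
  then have "node_inner N e e = 0"
    using orth_all_nodes_zero assms(1) by (simp add: node_inner_self_eq_0)
  then show ?case using dirichlet_nonneg by simp
next
  case (step n)
  define c where "c = real (Suc n) * real (Suc (Suc n))"
  obtain m where m: "degree m \<le> n" "orth_poly_upto N n (\<lambda>x. poly (monom 1 (Suc n)) x - poly m x)"
    using ex_projection[of N n] assms(1) step.hyps by force
  obtain p where p: "degree p = Suc n" "lead_coeff p = 1" "orth_poly_upto N n (poly p)"
      "node_inner N (poly p) (poly p) \<noteq> 0"
    using monic_orth_of_projection[OF assms(1) _ m] step.hyps by auto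
  have eigen: "dirichlet N (poly p) v = c * node_inner N (poly p) v" for v
  proof -
    \<comment> \<open>The defect \<open>r\<close> has degree at most \<open>n\<close> and is orthogonal to itself, so it vanishes at the nodes.\<close>
    define r where "r = sturm_op N p - smult c p"
    have r_deg: "degree r \<le> n"
    proof (rule degree_le, intro allI impI)
      fix i assume "n < i"
      then consider "i = Suc n" | "i > Suc n" by linarith
      then show "coeff r i = 0"
        using sturm_op_coeff[of N p "Suc n"] assms(1) p(1,2)
        by cases (auto simp: r_def c_def coeff_eq_0)
    qed
    have L: "poly (sturm_op N p) = (\<lambda>x. poly r x + c * poly p x)" by (auto simp: r_def)
    have D: "dirichlet N (poly p) w = node_inner N (poly r) w + c * node_inner N (poly p) w" for w
      unfolding dirichlet_eq_node_inner[OF assms(1)] L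
      by (simp only: node_inner_add node_inner_scale)
    have "dirichlet N (poly p) (poly r) = node_inner N (poly p) (poly (sturm_op N r))"
      using assms(1) by (metis dirichlet_commute dirichlet_eq_node_inner node_inner_commute)
    also have "\<dots> = 0"
      using p(3) sturm_op_coeff(1)[OF assms(1) r_deg] by (simp add: orth_poly_upto_def)
    finally have "node_inner N (poly r) (poly r) = 0"
      using D[of "poly r"] p(3) r_deg by (simp add: orth_poly_upto_def)
    then have "node_inner N (poly r) v = 0"
      by (simp add: node_inner_self_eq_0) (simp add: node_inner_def)
    then show ?thesis using D by simp
  qed
  define a where "a = node_inner N e (poly p) / node_inner N (poly p) (poly p)"
  define w where "w x = e x - a * poly p x" for x
  have e: "e = (\<lambda>x. a * poly p x + w x)" by (auto simp: w_def)
  have w_orth: "orth_poly_upto N (Suc n) w"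
    unfolding w_def by (rule orth_remove_component[OF step.prems p a_def])
  then have w_p: "node_inner N w (poly p) = 0" using p(1) by (simp add: orth_poly_upto_def)
  have "real (Suc (Suc n)) * real (Suc (Suc (Suc n))) * node_inner N w w \<le> dirichlet N w w"
    using step.IH[OF w_orth] .
  moreover have "c * node_inner N w w \<le> real (Suc (Suc n)) * real (Suc (Suc (Suc n))) * node_inner N w w"
    unfolding c_def by (intro mult_right_mono mult_mono node_inner_self_nonneg) auto
  ultimately have w: "c * node_inner N w w \<le> dirichlet N w w" by linarith
  have "c * node_inner N e e = a\<^sup>2 * (c * node_inner N (poly p) (poly p)) + c * node_inner N w w"
    using w_p node_inner_expand[of N a "poly p" w, folded e]
    by (simp add: node_inner_commute algebra_simps)
  also have "\<dots> \<le> a\<^sup>2 * dirichlet N (poly p) (poly p) + 2 * a * dirichlet N (poly p) w + dirichlet N w w"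
    using w w_p by (simp add: eigen node_inner_commute)
  also have "\<dots> = dirichlet N e e"
    using dirichlet_expand[of N a "poly p" w, folded e] by simp
  finally show ?case by (simp add: c_def)
qed

text \<open>
  The operator maps \<open>q\<close> to a polynomial of degree at most \<open>n\<close>, so \<open>q\<close> and the error are orthogonal
  also for the Dirichlet form; subtracting \<open>q\<close> can only decrease that form, and the spectral gap
  applies to the error.
\<close>

lemma projection_error_bound:
  assumes N: "N > 0" and n: "n \<le> N" "degree q \<le> n"
    and orth: "orth_poly_upto N n (\<lambda>x. u x - poly q x)"
  shows "real (Suc n) * real (Suc (Suc n)) * node_inner N (\<lambda>x. u x - poly q x) (\<lambda>x. u x - poly q x)
    \<le> dirichlet N u u"
proof -
  define e where "e x = u x - poly q x" for x
  have u: "u = (\<lambda>x. 1 * poly q x + e x)" by (auto simp: e_def)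
  have "dirichlet N (poly q) e = node_inner N e (poly (sturm_op N q))"
    using N by (simp add: dirichlet_eq_node_inner node_inner_commute)
  also have "\<dots> = 0"
    using orth sturm_op_coeff(1)[OF N n(2)] by (simp add: orth_poly_upto_def e_def[abs_def])
  finally have "dirichlet N e e \<le> dirichlet N u u"
    using dirichlet_nonneg[of N "poly q"] dirichlet_expand[of N 1 "poly q" e, folded u] by simp
  moreover have "real (Suc n) * real (Suc (Suc n)) * node_inner N e e \<le> dirichlet N e e"
    using spectral_gap[OF N n(1)] orth by (simp add: e_def[abs_def])
  ultimately show ?thesis by (simp add: e_def[abs_def])
qed

text \<open>
  Pythagoras: relative to the orthogonal projection, any other polynomial adds its squared distance
  to the projection, which is positive since \<open>n \<le> N\<close>.  So the minimizer is unique and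
  equals the projection.
\<close>

lemma LS_projection:
  assumes N: "N > 0" "n \<le> N"
  shows "degree (LS N n f) \<le> n" "orth_poly_upto N n (\<lambda>x. f x - poly (LS N n f) x)"
proof -
  obtain q where q: "degree q \<le> n" "orth_poly_upto N n (\<lambda>x. f x - poly q x)"
    using ex_projection[of N n f] N by blast
  have pyth: "sq_error N f p = sq_error N f q + node_inner N (poly (q - p)) (poly (q - p))"
    if "degree p \<le> n" for p
  proof -
    have "node_inner N (\<lambda>x. f x - poly q x) (poly (q - p)) = 0"
      using q that by (auto simp: orth_poly_upto_def intro: degree_diff_le)
    moreover have "sq_error N f p = node_inner N (\<lambda>x. 1 * (f x - poly q x) + poly (q - p) x)
        (\<lambda>x. 1 * (f x - poly q x) + poly (q - p) x)"
      unfolding sq_error_def node_inner_def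
      by (intro sum.cong) (auto simp: power2_eq_square algebra_simps)
    moreover have "sq_error N f q = node_inner N (\<lambda>x. f x - poly q x) (\<lambda>x. f x - poly q x)"
      unfolding sq_error_def node_inner_def
      by (intro sum.cong) (auto simp: power2_eq_square algebra_simps)
    moreover have "poly (q - p) = (\<lambda>x. poly q x - poly p x)" by auto
    ultimately show ?thesis by (simp only: node_inner_expand) simp
  qed
  have "LS N n f = q"
    unfolding LS_def
  proof (rule the_equality)
    show "is_arg_min (sq_error N f) (\<lambda>q. degree q \<le> n) q"
      unfolding is_arg_min_linorder using q(1) pyth node_inner_self_nonneg
      by (metis le_add_same_cancel1)
  next
    fix p assume p: "is_arg_min (sq_error N f) (\<lambda>q. degree q \<le> n) p"
    then have deg: "degree p \<le> n" and "sq_error N f p \<le> sq_error N f q"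
      using q(1) by (auto simp: is_arg_min_linorder)
    then have "node_inner N (poly (q - p)) (poly (q - p)) = 0"
      using pyth[of p] node_inner_self_nonneg[of N "poly (q - p)"] by linarith
    then have "q - p = 0"
      using N q(1) deg order.trans[OF degree_diff_le N(2)]
      by (intro poly_zero_of_nodes[of N]) (auto simp: node_inner_self_eq_0)
    then show "p = q" by simp
  qed
  then show "degree (LS N n f) \<le> n" "orth_poly_upto N n (\<lambda>x. f x - poly (LS N n f) x)"
    using q by auto
qed

section \<open>From mean square to uniform error\<close>

text \<open>
  The nodes are \<open>2 / N\<close> apart, and since the interval lies in \<open>[-1,1]\<close> no node in it is lost by the
  restriction to \<open>j \<le> N\<close>; rounding at the two ends costs at most one node.
\<close>

lemma card_nodes_in_interval:
  assumes N: "N > 0" and a: "-1 \<le> a" "a + d \<le> 1" and "d \<ge> 0"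
  shows "d * real N / 2 - 1 \<le> real (card {j. j \<le> N \<and> node N j \<in> {a..a + d}})"
proof -
  define s where "s = real N * (a + 1) / 2"
  define t where "t = real N * (a + d + 1) / 2"
  have st: "0 \<le> s" "t \<le> real N" "0 \<le> t"
    using assms mult_left_mono[of "a + d + 1" 2 "real N"] by (auto simp: s_def t_def)
  have t_s: "t - s = d * real N / 2" by (simp add: s_def t_def field_simps)
  have node_in: "node N j \<in> {a..a + d} \<longleftrightarrow> s \<le> real j \<and> real j \<le> t" for j
    using N by (auto simp: node_def s_def t_def field_simps)
  have "{nat \<lceil>s\<rceil>..nat \<lfloor>t\<rfloor>} \<subseteq> {j. j \<le> N \<and> node N j \<in> {a..a + d}}"
  proof
    fix j assume "j \<in> {nat \<lceil>s\<rceil>..nat \<lfloor>t\<rfloor>}"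
    then have "s \<le> real j" "real j \<le> t" using st by (auto simp: nat_le_iff ceiling_le_iff le_nat_iff le_floor_iff)
    then show "j \<in> {j. j \<le> N \<and> node N j \<in> {a..a + d}}" using st node_in by auto
  qed
  then have "card {nat \<lceil>s\<rceil>..nat \<lfloor>t\<rfloor>} \<le> card {j. j \<le> N \<and> node N j \<in> {a..a + d}}"
    by (intro card_mono) auto
  moreover have "t - s - 1 \<le> real (card {nat \<lceil>s\<rceil>..nat \<lfloor>t\<rfloor>})"
    using st by simp linarith
  ultimately show ?thesis using t_s by linarith
qed

lemma dirichlet_lipschitz:
  assumes N: "N > 0" and lip: "\<epsilon>-lipschitz_on {-1..1} u"
  shows "dirichlet N u u \<le> 4 * \<epsilon>\<^sup>2 * real N"
proof -
  have "dirichlet N u u \<le> (\<Sum>j<N. 4 * \<epsilon>\<^sup>2)"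
    unfolding dirichlet_def
  proof (rule sum_mono)
    fix j assume j: "j \<in> {..<N}"
    define d where "d = u (node N (Suc j)) - u (node N j)"
    have "\<bar>d\<bar> \<le> \<epsilon> * (2 / real N)"
      using lipschitz_onD[OF lip node_in[of "Suc j" N] node_in[of j N]] j N
      by (simp add: d_def dist_real_def node_Suc)
    then have d: "d\<^sup>2 \<le> (\<epsilon> * (2 / real N))\<^sup>2" by (metis abs_ge_zero power2_abs power_mono)
    have "real (Suc j) * real (N - j) * d\<^sup>2 \<le> real N * real N * (\<epsilon> * (2 / real N))\<^sup>2"
      using j d by (intro mult_mono) auto
    then show "real (Suc j) * real (N - j) * (u (node N (Suc j)) - u (node N j))
        * (u (node N (Suc j)) - u (node N j)) \<le> 4 * \<epsilon>\<^sup>2"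
      using N by (simp add: d_def power2_eq_square mult.assoc)
  qed
  then show ?thesis by (simp add: mult.commute)
qed

text \<open>
  At a point \<open>z\<close> where \<open>\<bar>e\<bar>\<close> has its maximum \<open>M\<close>, Markov's inequality is applied to \<open>q - u z\<close> rather
  than to \<open>q\<close>: as \<open>u\<close> varies by at most \<open>2 * \<epsilon>\<close>, this polynomial is bounded in terms of \<open>M\<close> and
  \<open>\<epsilon>\<close> alone, whatever the size of \<open>u\<close>.  The constants \<open>72\<close> and \<open>34\<close> are convenient, not optimal.
\<close>

lemma uniform_projection_error:
  fixes u :: "real \<Rightarrow> real"
  assumes n: "n > 0" and N: "72 * n\<^sup>2 \<le> N" and lip: "\<epsilon>-lipschitz_on {-1..1} u"
    and q: "degree q \<le> n" and orth: "orth_poly_upto N n (\<lambda>x. u x - poly q x)"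
    and x: "x \<in> {-1..1}"
  shows "\<bar>u x - poly q x\<bar> \<le> 34 * \<epsilon>"
proof -
  define e where "e t = u t - poly q t" for t
  have eps: "\<epsilon> \<ge> 0" using lipschitz_on_nonneg[OF lip] .
  have n_sq: "n \<le> n\<^sup>2" "1 \<le> n\<^sup>2" using n by (auto simp: power2_eq_square)
  have N0: "N > 0" "n \<le> N" using N n_sq by linarith+
  have "continuous_on {-1..1} (\<lambda>t. \<bar>e t\<bar>)"
    unfolding e_def using lipschitz_on_continuous_on[OF lip] by (intro continuous_intros)
  then obtain z where z: "z \<in> {-1..1}" "\<And>t. t \<in> {-1..1} \<Longrightarrow> \<bar>e t\<bar> \<le> \<bar>e z\<bar>"
    using continuous_attains_sup[of "{-1..1::real}" "\<lambda>t. \<bar>e t\<bar>"] by auto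
  define M where "M = \<bar>e z\<bar>"
  have "M \<le> 34 * \<epsilon>"
  proof (rule ccontr)
    assume "\<not> M \<le> 34 * \<epsilon>"
    then have M: "M > 34 * \<epsilon>" "M > 0" "M \<ge> \<epsilon>" using eps by auto
    have u_diff: "\<bar>u s - u t\<bar> \<le> \<epsilon> * \<bar>s - t\<bar>" if "s \<in> {-1..1}" "t \<in> {-1..1}" for s t
      using lipschitz_onD[OF lip that] by (simp add: dist_real_def)
    have "\<bar>poly (q - [:u z:]) t\<bar> < 4 * M" if "t \<in> {-1..1}" for t
    proof -
      have "\<epsilon> * \<bar>t - z\<bar> \<le> \<epsilon> * 2" using eps that z(1) by (intro mult_left_mono) auto
      then have "\<bar>u t - u z\<bar> \<le> 2 * \<epsilon>" using u_diff[OF that z(1)] by linarith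
      moreover have "\<bar>e t\<bar> \<le> M" using z(2)[OF that] by (simp add: M_def)
      ultimately show ?thesis using M by (simp add: e_def)
    qed
    then have q': "\<bar>poly (pderiv q) t\<bar> \<le> 8 * (real n)\<^sup>2 * M" if "t \<in> {-1..1}" for t
      using markov[of "q - [:u z:]" n "4 * M" t] that q
      by (simp add: pderiv_diff pderiv_pCons degree_diff_le)
    have q_diff: "\<bar>poly q s - poly q t\<bar> \<le> 8 * (real n)\<^sup>2 * M * \<bar>s - t\<bar>"
      if "s \<in> {-1..1}" "t \<in> {-1..1}" for s t
      using field_differentiable_bound[of "{-1..1}" "poly q" "poly (pderiv q)" "8 * (real n)\<^sup>2 * M" s t]
        q' that by (auto intro: DERIV_subset[OF poly_DERIV])
    \<comment> \<open>The slope of \<open>e\<close> is at most \<open>8 * n\<^sup>2 * M + \<epsilon> \<le> 9 * n\<^sup>2 * M\<close>, so over this distance \<open>e\<close> changes by at most \<open>M / 2\<close>.\<close>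
    define d where "d = 1 / (18 * (real n)\<^sup>2)"
    have rn: "(real n)\<^sup>2 \<ge> 1" using n by simp
    have d: "d > 0" "d \<le> 1" 
    proof -
      show "d > 0" using n by (simp add: d_def)
      have "1 \<le> 18 * (real n)\<^sup>2" using rn by linarith
      then show "d \<le> 1" unfolding d_def by (subst divide_le_eq_1_pos) linarith+
    qed
    have eps_le: "\<epsilon> \<le> (real n)\<^sup>2 * M" using M mult_right_mono[OF rn, of M] by linarith
    have e_large: "M / 2 \<le> \<bar>e t\<bar>" if "t \<in> {-1..1}" "\<bar>t - z\<bar> \<le> d" for t
    proof -
      have "\<bar>e t - e z\<bar> \<le> 8 * (real n)\<^sup>2 * M * \<bar>t - z\<bar> + \<epsilon> * \<bar>t - z\<bar>"
        using u_diff[OF that(1) z(1)] q_diff[OF that(1) z(1)] by (simp add: e_def)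
      also have "\<dots> = (8 * (real n)\<^sup>2 * M + \<epsilon>) * \<bar>t - z\<bar>" by (simp add: algebra_simps)
      also have "\<dots> \<le> (8 * (real n)\<^sup>2 * M + (real n)\<^sup>2 * M) * d"
        using M(2) eps that(2) eps_le by (intro mult_mono add_mono) auto
      also have "\<dots> = M / 2" using n by (simp add: d_def field_simps)
      finally show ?thesis unfolding M_def by linarith
    qed
    \<comment> \<open>The interval of length \<open>d\<close> starts at \<open>z\<close> and points away from the nearer end of \<open>[-1,1]\<close>.\<close>
    define a where "a = (if z \<ge> 0 then z - d else z)"
    have a: "-1 \<le> a" "a + d \<le> 1" using z(1) d by (auto simp: a_def)
    define J where "J = {j. j \<le> N \<and> node N j \<in> {a..a + d}}"
    \<comment> \<open>The hypothesis on \<open>N\<close> makes \<open>d * N / 2\<close> at least \<open>2\<close>, so the node lost by rounding is at most half of the count.\<close>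
    have "72 * (real n)\<^sup>2 \<le> real N" using N by (metis of_nat_le_iff of_nat_mult of_nat_numeral of_nat_power)
    then have "1 \<le> real N / (72 * (real n)\<^sup>2)" using n by (subst le_divide_eq_1_pos) auto
    moreover have "d * real N / 2 = 2 * (real N / (72 * (real n)\<^sup>2))" by (simp add: d_def)
    ultimately have card: "real N / (72 * (real n)\<^sup>2) \<le> real (card J)"
      using card_nodes_in_interval[OF N0(1) a] d(1) unfolding J_def by linarith
    have "real (card J) * (M / 2)\<^sup>2 = (\<Sum>j\<in>J. (M / 2)\<^sup>2)" by simp
    also have "\<dots> \<le> (\<Sum>j\<in>J. e (node N j) * e (node N j))"
    proof (rule sum_mono)
      fix j assume "j \<in> J"
      then have j: "node N j \<in> {a..a + d}" by (simp add: J_def)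
      then have "M / 2 \<le> \<bar>e (node N j)\<bar>"
        using a d by (intro e_large) (auto simp: a_def split: if_splits)
      then show "(M / 2)\<^sup>2 \<le> e (node N j) * e (node N j)"
        using M(2) by (metis abs_le_square_iff abs_of_pos half_gt_zero power2_eq_square)
    qed
    also have "\<dots> \<le> node_inner N e e"
      unfolding node_inner_def by (intro sum_mono2) (auto simp: J_def)
    finally have lower: "real N / (72 * (real n)\<^sup>2) * (M / 2)\<^sup>2 \<le> node_inner N e e"
      using mult_right_mono[OF card, of "(M / 2)\<^sup>2"] by simp
    have "(real n)\<^sup>2 * node_inner N e e \<le> real (Suc n) * real (Suc (Suc n)) * node_inner N e e"
      unfolding power2_eq_square by (intro mult_right_mono mult_mono node_inner_self_nonneg) auto
    also have "\<dots> \<le> 4 * \<epsilon>\<^sup>2 * real N"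
      using projection_error_bound[OF N0 q orth] dirichlet_lipschitz[OF N0(1) lip]
      by (simp add: e_def[abs_def])
    finally have "(real n)\<^sup>2 * (real N / (72 * (real n)\<^sup>2) * (M / 2)\<^sup>2) \<le> 4 * \<epsilon>\<^sup>2 * real N"
      using mult_left_mono[OF lower, of "(real n)\<^sup>2"] by simp
    then have "M\<^sup>2 \<le> 1152 * \<epsilon>\<^sup>2" using n N0 by (simp add: power_divide)
    moreover have "(34 * \<epsilon>)\<^sup>2 < M\<^sup>2" using M eps by (intro power_strict_mono) auto
    ultimately show False using zero_le_power2[of \<epsilon>] by (simp add: power_mult_distrib)
  qed
  then show ?thesis using z(2)[OF x] by (simp add: M_def e_def)
qed

lemma ex_poly_antiderivative: "\<exists>Q :: real poly. pderiv Q = q"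
proof
  have "pderiv (\<Sum>i\<le>degree q. monom (coeff q i / real (Suc i)) (Suc i))
    = (\<Sum>i\<le>degree q. monom (coeff q i) i)"
    by (subst sum_comp_morphism[of pderiv, symmetric])
      (auto simp: pderiv_add pderiv_monom o_def simp del: of_nat_Suc)
  then show "pderiv (\<Sum>i\<le>degree q. monom (coeff q i / real (Suc i)) (Suc i)) = q"
    by (simp add: poly_as_sum_of_monoms)
qed

text \<open>
  Weierstrass approximation of the derivative, integrated.
\<close>

lemma C1_poly_plus_small_lipschitz:
  fixes f f' :: "real \<Rightarrow> real"
  assumes deriv: "\<And>y. y \<in> {a..b} \<Longrightarrow> (f has_real_derivative f' y) (at y within {a..b})"
    and cont: "continuous_on {a..b} f'" and eps: "\<epsilon> > 0"
  obtains Q where "\<epsilon>-lipschitz_on {a..b} (\<lambda>y. f y - poly Q y)"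
proof -
  obtain g where g: "real_polynomial_function g" "\<And>y. y \<in> {a..b} \<Longrightarrow> \<bar>f' y - g y\<bar> < \<epsilon>"
    using Stone_Weierstrass_real_polynomial_function[OF compact_Icc cont eps] by blast
  obtain c m where c: "g = (\<lambda>x. \<Sum>i\<le>m. c i * x ^ i)"
    using g(1) by (auto simp: real_polynomial_function_iff_sum)
  define q where "q = (\<Sum>i\<le>m. monom (c i) i)"
  have gq: "g = poly q" by (auto simp: c q_def poly_sum poly_monom)
  obtain Q where Q: "pderiv Q = q" using ex_poly_antiderivative by blast
  have "\<epsilon>-lipschitz_on {a..b} (\<lambda>y. f y - poly Q y)"
  proof (rule lipschitz_onI)
    fix s t assume st: "s \<in> {a..b}" "t \<in> {a..b}"
    have "norm ((f s - poly Q s) - (f t - poly Q t)) \<le> \<epsilon> * norm (s - t)"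
    proof (rule field_differentiable_bound[where f' = "\<lambda>y. f' y - g y" and S = "{a..b}"])
      fix y assume y: "y \<in> {a..b}"
      show "((\<lambda>y. f y - poly Q y) has_field_derivative f' y - g y) (at y within {a..b})"
        using deriv[OF y] DERIV_subset[OF poly_DERIV[of Q y]] Q gq by (auto intro: DERIV_diff)
      show "norm (f' y - g y) \<le> \<epsilon>" using g(2)[OF y] by simp
    qed (use st in auto)
    then show "dist (f s - poly Q s) (f t - poly Q t) \<le> \<epsilon> * dist s t"
      by (simp add: dist_real_def)
  qed (use eps in simp)
  then show thesis by (rule that)
qed

theorem corollary1p1:
  fixes f f' :: "real \<Rightarrow> real" and N :: "nat \<Rightarrow> nat" and x :: real
  assumes deriv: "\<And>y. y \<in> {-1..1} \<Longrightarrow> (f has_real_derivative f' y) (at y within {-1..1})"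
    and cont: "continuous_on {-1..1} f'"
    and bv: "f' \<in> BV (-1) 1"
    and pos: "\<forall>\<^sub>F n in sequentially. N n > 0"
    and lim: "(\<lambda>n. real n ^ 4 / real (N n)) \<longlonglongrightarrow> 0"
    and x: "x \<in> {-1..1}"
  shows "(\<lambda>n. poly (LS (N n) n f) x) \<longlonglongrightarrow> f x"
proof (rule tendstoI)
  fix \<eta> :: real assume eta: "\<eta> > 0"
  \<comment> \<open>The uniform error \<open>34 * \<epsilon>\<close> must stay strictly below \<open>\<eta>\<close>.\<close>
  define \<epsilon> where "\<epsilon> = \<eta> / 35"
  have eps: "\<epsilon> > 0" using eta by (simp add: \<epsilon>_def)
  obtain Q where Q: "\<epsilon>-lipschitz_on {-1..1} (\<lambda>y. f y - poly Q y)"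
    using C1_poly_plus_small_lipschitz[OF deriv cont eps] by blast
  have "\<forall>\<^sub>F n in sequentially. real n ^ 4 / real (N n) < 1 / 72"
    by (rule order_tendstoD(2)[OF lim]) simp
  moreover have "\<forall>\<^sub>F n in sequentially. n \<ge> max 1 (degree Q)" by (rule eventually_ge_at_top)
  ultimately show "\<forall>\<^sub>F n in sequentially. dist (poly (LS (N n) n f) x) (f x) < \<eta>"
    using pos
  proof eventually_elim
    case (elim n)
    have n: "n > 0" "degree Q \<le> n" using elim by auto
    have "72 * real n ^ 4 < real (N n)" using elim by (simp add: field_simps)
    then have "72 * n ^ 4 < N n" by (metis of_nat_less_iff of_nat_mult of_nat_numeral of_nat_power)
    moreover have "n\<^sup>2 \<le> n ^ 4" using n by (intro power_increasing) auto
    ultimately have N: "72 * n\<^sup>2 \<le> N n" by linarith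
    moreover have "n \<le> n\<^sup>2" by (simp add: power2_eq_square)
    ultimately have nN: "n \<le> N n" by linarith
    \<comment> \<open>The least squares approximation of the remainder \<open>f - Q\<close>; its error is the same as that of \<open>f\<close>.\<close>
    define q where "q = LS (N n) n f - Q"
    have q: "degree q \<le> n"
      unfolding q_def using LS_projection(1)[OF elim(3) nN] n by (intro degree_diff_le)
    have err: "(\<lambda>y. f y - poly Q y - poly q y) = (\<lambda>y. f y - poly (LS (N n) n f) y)"
      by (auto simp: q_def)
    have "\<bar>f x - poly Q x - poly q x\<bar> \<le> 34 * \<epsilon>"
      using LS_projection(2)[OF elim(3) nN] err
      by (intro uniform_projection_error[OF n(1) N Q q _ x]) simp
    then show ?case using eta by (simp add: q_def \<epsilon>_def dist_real_def abs_minus_commute)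
  qed
qed

end
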